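(* Let $A,B\subseteq\mathbb{N}$ be r.e. sets. If $A$ and $B$ are uniform ($A\sim B$), then $A$ and $B$ belong to the same Turing-reducibility equivalence class, i.e. $A\equiv_T B$.
   Context: $\mathbb{N}=\{1,2,3,\dots\}$. A listing of an r.e. set $A\subseteq\mathbb{N}$ is a bijective computable function onto $A$: if $A$ is infinite it is a total computable bijection $h:\mathbb{N}\to A$; if $A$ is finite with $n$ elements it is a bijection $h:\{1,\dots,n\}\to A$. Two listings $h,g$ with the same domain are uniform, $h\sim g$, if $h(i)<h(j)\Leftrightarrow g(i)<g(j)$ for all $i,j$ in the domain. Two r.e. sets $A,B$ of equal cardinality are uniform, $A\sim B$, if there exist a listing $h$ of $A$ and a listing $g$ of $B$ with $h\sim g$. *)

theory Defs
  imports Main "HOL-Library.Equipollence"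
begin

text \<open>
  A \<open>k\<close>-ary partial function on the natural numbers is a function on lists of which only the
  values on lists of length \<open>k\<close> matter; \<^const>\<open>None\<close> means undefined.
\<close>

definition compose :: "(nat list \<Rightarrow> nat option) \<Rightarrow> (nat list \<Rightarrow> nat option) list
    \<Rightarrow> nat list \<Rightarrow> nat option" where
  "compose f gs xs = Option.bind (those (map (\<lambda>g. g xs) gs)) f"

text \<open>The recursion argument comes first; \<open>g\<close> receives the counter, the previous value and the
  parameters.\<close>

primrec primitive_recursion :: "(nat list \<Rightarrow> nat option) \<Rightarrow> (nat list \<Rightarrow> nat option)
    \<Rightarrow> nat \<Rightarrow> nat list \<Rightarrow> nat option" where
  "primitive_recursion f g 0 xs = f xs"
| "primitive_recursion f g (Suc n) xs =
     Option.bind (primitive_recursion f g n xs) (\<lambda>y. g (n # y # xs))"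

text \<open>The value is defined only if all tests before the first zero are defined.\<close>

definition minimization :: "(nat list \<Rightarrow> nat option) \<Rightarrow> nat list \<Rightarrow> nat option" where
  "minimization f xs =
     (if \<exists>n. f (n # xs) = Some 0 \<and> (\<forall>m<n. f (m # xs) \<noteq> None)
      then Some (LEAST n. f (n # xs) = Some 0) else None)"

text \<open>
  The partial functions that are recursive in a set \<open>F\<close> of total unary functions. The
  case \<open>F = {}\<close> gives the partial recursive functions; \<open>F = {\<chi>}\<close>, with \<open>\<chi>\<close> the characteristic
  function of a set, gives the functions partial recursive relative to that set.
\<close>

inductive recursive_in :: "(nat \<Rightarrow> nat) set \<Rightarrow> nat \<Rightarrow> (nat list \<Rightarrow> nat option) \<Rightarrow> bool"
  for F where
  zero: "recursive_in F k (\<lambda>xs. Some 0)"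
| succ: "recursive_in F 1 (\<lambda>xs. Some (Suc (hd xs)))"
| proj: "i < k \<Longrightarrow> recursive_in F k (\<lambda>xs. Some (xs ! i))"
| base: "\<phi> \<in> F \<Longrightarrow> recursive_in F 1 (\<lambda>xs. Some (\<phi> (hd xs)))"
| comp: "recursive_in F (length gs) f \<Longrightarrow> (\<forall>g \<in> set gs. recursive_in F k g)
    \<Longrightarrow> recursive_in F k (compose f gs)"
| prec: "recursive_in F k f \<Longrightarrow> recursive_in F (Suc (Suc k)) g
    \<Longrightarrow> recursive_in F (Suc k) (\<lambda>xs. primitive_recursion f g (hd xs) (tl xs))"
| mu: "recursive_in F (Suc k) f \<Longrightarrow> recursive_in F k (minimization f)"

definition partial_computable_in :: "(nat \<Rightarrow> nat) set \<Rightarrow> (nat \<rightharpoonup> nat) \<Rightarrow> bool" where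
  "partial_computable_in F \<phi> \<longleftrightarrow> (\<exists>f. recursive_in F 1 f \<and> (\<forall>x. f [x] = \<phi> x))"

definition partial_computable :: "(nat \<rightharpoonup> nat) \<Rightarrow> bool" where
  "partial_computable \<phi> \<longleftrightarrow> partial_computable_in {} \<phi>"

definition re_set :: "nat set \<Rightarrow> bool" where
  "re_set A \<longleftrightarrow> (\<exists>\<phi>. partial_computable \<phi> \<and> dom \<phi> = A)"

definition char_fun :: "nat set \<Rightarrow> nat \<Rightarrow> nat" where
  "char_fun A x = (if x \<in> A then 1 else 0)"

definition turing_reducible :: "nat set \<Rightarrow> nat set \<Rightarrow> bool"  (infix "\<le>\<^sub>T" 50) where
  "A \<le>\<^sub>T B \<longleftrightarrow> partial_computable_in {char_fun B} (\<lambda>x. Some (char_fun A x))"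

definition turing_equiv :: "nat set \<Rightarrow> nat set \<Rightarrow> bool"  (infix "\<equiv>\<^sub>T" 50) where
  "A \<equiv>\<^sub>T B \<longleftrightarrow> A \<le>\<^sub>T B \<and> B \<le>\<^sub>T A"

text \<open>
  Listings are indexed from 1: the index 0 lies outside the domain, and in the infinite case
  totality means being defined on the positive integers.
\<close>

definition listing :: "nat set \<Rightarrow> (nat \<rightharpoonup> nat) \<Rightarrow> bool" where
  "listing A h \<longleftrightarrow> partial_computable h \<and>
     dom h = (if finite A then {1..card A} else {1..}) \<and>
     bij_betw (\<lambda>i. the (h i)) (dom h) A"

definition uniform_listings :: "(nat \<rightharpoonup> nat) \<Rightarrow> (nat \<rightharpoonup> nat) \<Rightarrow> bool" where
  "uniform_listings h g \<longleftrightarrow> dom h = dom g \<and>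
     (\<forall>i \<in> dom h. \<forall>j \<in> dom h. the (h i) < the (h j) \<longleftrightarrow> the (g i) < the (g j))"

definition uniform_sets :: "nat set \<Rightarrow> nat set \<Rightarrow> bool" where
  "uniform_sets A B \<longleftrightarrow> A \<approx> B \<and>
     (\<exists>h g. listing A h \<and> listing B g \<and> uniform_listings h g)"

end

theory Submission imports Defs
begin

text \<open>
  For finite \<open>A\<close> and \<open>B\<close> both characteristic functions are computable. Otherwise let \<open>h\<close> and \<open>g\<close>
  be uniform listings of \<open>A\<close> and \<open>B\<close>. The map \<open>g(i) \<mapsto> h(i)\<close> is an order isomorphism \<open>K\<close> from \<open>B\<close>
  onto \<open>A\<close>, and a \<open>B\<close>-oracle computes \<open>K\<close> and decides its domain. Since \<open>A\<close> is infinite, there is a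
  least \<open>c \<in> B\<close> with \<open>n \<le> K(c)\<close>; then \<open>n \<in> A\<close> iff \<open>K(c) = n\<close>.
\<close>

section \<open>Total relative recursive functions: composition, recursion, search\<close>

lemma recursive_in_mono:
  assumes "recursive_in F k f" and "F \<subseteq> G"
  shows "recursive_in G k f"
  using assms(1)
proof induction
  case (comp gs f k)
  then show ?case by (intro recursive_in.comp) auto
qed (use assms(2) in \<open>auto intro: recursive_in.intros simp del: One_nat_def\<close>)

text \<open>Values on lists of the wrong length are arbitrary in \<open>recursive_in\<close>. Fixing
  them only on length \<open>k\<close> permits any convenient HOL expression for
  \<open>f\<close>.\<close>

definition total_recursive_in :: "(nat \<Rightarrow> nat) set \<Rightarrow> nat \<Rightarrow> (nat list \<Rightarrow> nat) \<Rightarrow> bool" where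
  "total_recursive_in F k f \<longleftrightarrow>
     (\<exists>p. recursive_in F k p \<and> (\<forall>xs. length xs = k \<longrightarrow> p xs = Some (f xs)))"

lemma total_recursive_in_cong:
  assumes "total_recursive_in F k f" and "\<And>xs. length xs = k \<Longrightarrow> f xs = g xs"
  shows "total_recursive_in F k g"
  using assms unfolding total_recursive_in_def by auto

lemma total_recursive_in_proj: "i < k \<Longrightarrow> total_recursive_in F k (\<lambda>xs. xs ! i)"
  unfolding total_recursive_in_def using recursive_in.proj by blast

lemma total_recursive_in_comp:
  assumes "total_recursive_in F (length gs) f"
    and "\<forall>g \<in> set gs. total_recursive_in F k g"
  shows "total_recursive_in F k (\<lambda>xs. f (map (\<lambda>g. g xs) gs))"
proof -
  obtain p where p: "recursive_in F (length gs) p"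
    "\<And>xs. length xs = length gs \<Longrightarrow> p xs = Some (f xs)"
    using assms(1) unfolding total_recursive_in_def by blast
  obtain q where q: "\<And>g. g \<in> set gs \<Longrightarrow> recursive_in F k (q g)"
    "\<And>g xs. g \<in> set gs \<Longrightarrow> length xs = k \<Longrightarrow> q g xs = Some (g xs)"
    using assms(2) unfolding total_recursive_in_def by metis
  \<comment> \<open>Stated for lists \<open>hs\<close> within \<open>gs\<close>, because
    \<open>q\<close> depends on \<open>gs\<close>, which must stay fixed in the induction.\<close>
  have "those (map (\<lambda>g. g xs) (map q hs)) = Some (map (\<lambda>g. g xs) hs)"
    if "set hs \<subseteq> set gs" "length xs = k" for hs xs
    using that by (induction hs) (auto simp: q(2))
  then have "compose p (map q gs) xs = Some (f (map (\<lambda>g. g xs) gs))" if "length xs = k" for xs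
    using that by (simp add: compose_def p(2))
  moreover have "recursive_in F k (compose p (map q gs))"
    using p(1) q(1) by (intro recursive_in.comp) auto
  ultimately show ?thesis
    unfolding total_recursive_in_def by blast
qed

text \<open>This and the binary version turn a recursive function into a rule for arbitrary argument
  expressions, so that later goals can be decomposed along the syntax of the term.\<close>

lemma total_recursive_in_comp1:
  assumes "total_recursive_in F 1 (\<lambda>xs. u (xs ! 0))" and "total_recursive_in F k a"
  shows "total_recursive_in F k (\<lambda>xs. u (a xs))"
  using total_recursive_in_comp[of F "[a]" "\<lambda>xs. u (xs ! 0)" k] assms by simp

lemma total_recursive_in_comp2:
  assumes "total_recursive_in F 2 (\<lambda>xs. u (xs ! 0) (xs ! 1))"
    and "total_recursive_in F k a" and "total_recursive_in F k b"
  shows "total_recursive_in F k (\<lambda>xs. u (a xs) (b xs))"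
  using total_recursive_in_comp[of F "[a, b]" "\<lambda>xs. u (xs ! 0) (xs ! 1)" k] assms
  by (simp add: numeral_2_eq_2)

lemma total_recursive_in_prec:
  assumes "total_recursive_in F k f" and "total_recursive_in F (Suc (Suc k)) g"
  shows "total_recursive_in F (Suc k)
    (\<lambda>xs. rec_nat (f (tl xs)) (\<lambda>n y. g (n # y # tl xs)) (hd xs))"
proof -
  obtain p q where p: "recursive_in F k p" "\<And>xs. length xs = k \<Longrightarrow> p xs = Some (f xs)"
    and q: "recursive_in F (Suc (Suc k)) q"
      "\<And>xs. length xs = Suc (Suc k) \<Longrightarrow> q xs = Some (g xs)"
    using assms unfolding total_recursive_in_def by blast
  have "primitive_recursion p q n xs = Some (rec_nat (f xs) (\<lambda>n y. g (n # y # xs)) n)"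
    if "length xs = k" for n xs
    using that by (induction n) (auto simp: p q)
  then show ?thesis
    unfolding total_recursive_in_def
    by (intro exI[of _ "\<lambda>xs. primitive_recursion p q (hd xs) (tl xs)"])
      (auto intro: recursive_in.prec p q)
qed

text \<open>A total test is defined at every candidate, so halting of the search reduces to the
  existence of a zero.\<close>

lemma total_recursive_in_mu:
  assumes "total_recursive_in F (Suc k) f" and "\<And>xs. length xs = k \<Longrightarrow> \<exists>n. f (n # xs) = 0"
  shows "total_recursive_in F k (\<lambda>xs. LEAST n. f (n # xs) = 0)"
proof -
  obtain p where p: "recursive_in F (Suc k) p"
    "\<And>xs. length xs = Suc k \<Longrightarrow> p xs = Some (f xs)"
    using assms(1) unfolding total_recursive_in_def by blast
  have "minimization p xs = Some (LEAST n. f (n # xs) = 0)" if "length xs = k" for xs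
    using assms(2)[OF that] that by (simp add: minimization_def p(2))
  then show ?thesis
    unfolding total_recursive_in_def using recursive_in.mu[OF p(1)] by blast
qed

section \<open>Arithmetic and the equality test\<close>

lemma total_recursive_in_Suc:
  assumes "total_recursive_in F k a"
  shows "total_recursive_in F k (\<lambda>xs. Suc (a xs))"
proof (rule total_recursive_in_comp1[OF _ assms])
  show "total_recursive_in F 1 (\<lambda>xs. Suc (xs ! 0))"
    unfolding total_recursive_in_def using recursive_in.succ
    by (intro exI[of _ "\<lambda>xs. Some (Suc (hd xs))"]) (auto simp: length_Suc_conv)
qed

lemma total_recursive_in_const: "total_recursive_in F k (\<lambda>xs. c)"
proof (induction c)
  case 0
  show ?case unfolding total_recursive_in_def using recursive_in.zero by blast
qed (rule total_recursive_in_Suc)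

lemma total_recursive_in_add:
  assumes "total_recursive_in F k a" and "total_recursive_in F k b"
  shows "total_recursive_in F k (\<lambda>xs. a xs + b xs)"
proof (rule total_recursive_in_comp2[OF _ assms])
  \<comment> \<open>In the step function, position 0 holds the counter, 1 the previous value and 2
    the first parameter.\<close>
  have "total_recursive_in F (Suc 1)
    (\<lambda>xs. rec_nat (tl xs ! 0) (\<lambda>n y. Suc ((n # y # tl xs) ! 1)) (hd xs))"
    by (rule total_recursive_in_prec) (auto intro!: total_recursive_in_proj total_recursive_in_Suc)
  moreover have "rec_nat x (\<lambda>n y. Suc y) n = n + x" for x n
    by (induction n) auto
  ultimately show "total_recursive_in F 2 (\<lambda>xs. xs ! 0 + xs ! 1)"
    unfolding numeral_2_eq_2 One_nat_def
    by (elim total_recursive_in_cong) (auto simp: length_Suc_conv)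
qed

lemma total_recursive_in_mult:
  assumes "total_recursive_in F k a" and "total_recursive_in F k b"
  shows "total_recursive_in F k (\<lambda>xs. a xs * b xs)"
proof (rule total_recursive_in_comp2[OF _ assms])
  have "total_recursive_in F (Suc 1)
    (\<lambda>xs. rec_nat 0 (\<lambda>n y. (n # y # tl xs) ! 1 + (n # y # tl xs) ! 2) (hd xs))"
    by (rule total_recursive_in_prec)
      (auto intro!: total_recursive_in_proj total_recursive_in_add total_recursive_in_const)
  moreover have "rec_nat 0 (\<lambda>n y. y + x) n = n * x" for x n :: nat
    by (induction n) auto
  ultimately show "total_recursive_in F 2 (\<lambda>xs. xs ! 0 * xs ! 1)"
    unfolding numeral_2_eq_2 One_nat_def
    by (elim total_recursive_in_cong) (auto simp: length_Suc_conv)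
qed

lemma total_recursive_in_pred:
  assumes "total_recursive_in F k a"
  shows "total_recursive_in F k (\<lambda>xs. a xs - 1)"
proof (rule total_recursive_in_comp1[OF _ assms])
  have "total_recursive_in F (Suc 0) (\<lambda>xs. rec_nat 0 (\<lambda>n y. (n # y # tl xs) ! 0) (hd xs))"
    by (rule total_recursive_in_prec)
      (auto intro!: total_recursive_in_proj total_recursive_in_const)
  moreover have "rec_nat 0 (\<lambda>n y. n) n = n - 1" for n :: nat
    by (cases n) auto
  ultimately show "total_recursive_in F 1 (\<lambda>xs. xs ! 0 - 1)"
    unfolding One_nat_def
    by (elim total_recursive_in_cong) (auto simp: length_Suc_conv)
qed

lemma total_recursive_in_diff:
  assumes "total_recursive_in F k a" and "total_recursive_in F k b"
  shows "total_recursive_in F k (\<lambda>xs. a xs - b xs)"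
proof (rule total_recursive_in_comp2[OF _ assms(2,1)])
  \<comment> \<open>The arguments are swapped: the recursion runs over its first argument and
    iterates the predecessor, so the subtrahend has to come first.\<close>
  have "total_recursive_in F (Suc 1)
    (\<lambda>xs. rec_nat (tl xs ! 0) (\<lambda>n y. (n # y # tl xs) ! 1 - 1) (hd xs))"
    by (rule total_recursive_in_prec)
      (auto intro!: total_recursive_in_proj total_recursive_in_pred[unfolded One_nat_def])
  moreover have "rec_nat x (\<lambda>n y. y - Suc 0) n = x - n" for x n
    by (induction n) auto
  ultimately show "total_recursive_in F 2 (\<lambda>xs. xs ! 1 - xs ! 0)"
    unfolding numeral_2_eq_2 One_nat_def
    by (elim total_recursive_in_cong) (auto simp: length_Suc_conv)
qed

lemma total_recursive_in_of_bool_eq: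
  assumes "total_recursive_in F k a" and "total_recursive_in F k b"
  shows "total_recursive_in F k (\<lambda>xs. of_bool (a xs = b xs))"
proof -
  \<comment> \<open>With truncated subtraction, one of the two differences is 0 and their sum is the
    distance of the two values.\<close>
  have "total_recursive_in F k (\<lambda>xs. 1 - ((a xs - b xs) + (b xs - a xs)))"
    by (intro total_recursive_in_diff total_recursive_in_add total_recursive_in_const assms)
  then show ?thesis by (rule total_recursive_in_cong) auto
qed

section \<open>Oracles, characteristic functions and listings\<close>

lemma total_recursive_in_oracle:
  assumes "\<phi> \<in> F" and "total_recursive_in F k a"
  shows "total_recursive_in F k (\<lambda>xs. \<phi> (a xs))"
proof (rule total_recursive_in_comp1[OF _ assms(2)])
  show "total_recursive_in F 1 (\<lambda>xs. \<phi> (xs ! 0))"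
    unfolding total_recursive_in_def using recursive_in.base[OF assms(1)]
    by (intro exI[of _ "\<lambda>xs. Some (\<phi> (hd xs))"]) (auto simp: length_Suc_conv)
qed

lemma turing_reducible_iff:
  "A \<le>\<^sub>T B \<longleftrightarrow> total_recursive_in {char_fun B} 1 (\<lambda>xs. char_fun A (xs ! 0))"
proof -
  have "(\<forall>xs. length xs = 1 \<longrightarrow> p xs = Some (char_fun A (xs ! 0))) \<longleftrightarrow>
      (\<forall>x. p [x] = Some (char_fun A x))" for p
    by (auto simp: length_Suc_conv)
  then show ?thesis
    unfolding turing_reducible_def partial_computable_in_def total_recursive_in_def by simp
qed

text \<open>The characteristic function is a sum of equality tests, one for each element;
  distinctness of the elements keeps the sum at most 1.\<close>

lemma total_recursive_in_char_fun_finite: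
  assumes "finite A" and "total_recursive_in F k a"
  shows "total_recursive_in F k (\<lambda>xs. char_fun A (a xs))"
  using assms(1)
proof induction
  case empty
  show ?case by (simp add: char_fun_def total_recursive_in_const)
next
  case (insert x A)
  have "total_recursive_in F k (\<lambda>xs. char_fun A (a xs) + of_bool (a xs = x))"
    by (intro total_recursive_in_add total_recursive_in_of_bool_eq total_recursive_in_const
        insert.IH assms(2))
  then show ?case
    by (rule total_recursive_in_cong) (use insert.hyps in \<open>auto simp: char_fun_def\<close>)
qed

text \<open>Shifting the index by one skips the undefined value at 0 and gives a total function
  \<open>e\<close>. It is computable without an oracle, hence by \<open>recursive_in_mono\<close>
  relative to every \<open>F\<close>.\<close>

lemma infinite_listing:
  assumes "listing A h" and "infinite A"
  obtains e where "bij_betw e UNIV A" and "\<And>i. h (Suc i) = Some (e i)"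
    and "\<And>F k a. total_recursive_in F k a \<Longrightarrow> total_recursive_in F k (\<lambda>xs. e (a xs))"
proof
  let ?e = "\<lambda>i. the (h (Suc i))"
  have dom: "dom h = {1..}" and bij: "bij_betw (\<lambda>i. the (h i)) {1..} A"
    using assms by (auto simp: listing_def)
  have e: "h (Suc i) = Some (?e i)" for i
  proof -
    have "Suc i \<in> dom h" by (simp add: dom)
    then show ?thesis by auto
  qed
  then show "h (Suc i) = Some (?e i)" for i .
  have "bij_betw Suc UNIV {1..}"
    by (auto simp: bij_betw_def image_iff Suc_le_eq gr0_conv_Suc)
  from bij_betw_trans[OF this bij] show "bij_betw ?e UNIV A" by (simp add: comp_def)
  fix F k a
  assume a: "total_recursive_in F k a"
  obtain p where p: "recursive_in {} 1 p" "\<And>x. p [x] = h x"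
    using assms(1) unfolding listing_def partial_computable_def partial_computable_in_def by blast
  obtain q where q: "recursive_in F k q" "\<And>xs. length xs = k \<Longrightarrow> q xs = Some (Suc (a xs))"
    using total_recursive_in_Suc[OF a] unfolding total_recursive_in_def by blast
  have "recursive_in F k (compose p [q])"
    using recursive_in_mono[OF p(1), of F] q(1) by (intro recursive_in.comp) auto
  moreover have "compose p [q] xs = Some (?e (a xs))" if "length xs = k" for xs
    using that by (simp add: compose_def p q e[symmetric])
  ultimately show "total_recursive_in F k (\<lambda>xs. ?e (a xs))"
    unfolding total_recursive_in_def by blast
qed

section \<open>The reduction between infinite uniform sets\<close>

lemma turing_reducible_if_uniform_infinite:
  assumes A: "A \<subseteq> {1..}" "infinite A" and B: "infinite B"
    and hg: "listing A h" "listing B g" "uniform_listings h g"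
  shows "A \<le>\<^sub>T B"
proof -
  let ?F = "{char_fun B}"
  note B_rec = total_recursive_in_oracle[OF singletonI[of "char_fun B"]]
  obtain e where e: "bij_betw e UNIV A" "\<And>i. h (Suc i) = Some (e i)"
    and e_rec: "\<And>F k a. total_recursive_in F k a \<Longrightarrow> total_recursive_in F k (\<lambda>xs. e (a xs))"
    using infinite_listing[OF hg(1) A(2)] by metis
  obtain d where d: "bij_betw d UNIV B" "\<And>i. g (Suc i) = Some (d i)"
    and d_rec: "\<And>F k a. total_recursive_in F k a \<Longrightarrow> total_recursive_in F k (\<lambda>xs. d (a xs))"
    using infinite_listing[OF hg(2) B] by metis
  have order: "e i < e j \<longleftrightarrow> d i < d j" for i j
  proof -
    have "Suc i \<in> dom h" "Suc j \<in> dom h" by (auto simp: e)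
    then have "the (h (Suc i)) < the (h (Suc j)) \<longleftrightarrow> the (g (Suc i)) < the (g (Suc j))"
      using hg(3) unfolding uniform_listings_def by blast
    then show ?thesis by (simp add: e d)
  qed
  have inj_d: "d i = d j \<longleftrightarrow> i = j" for i j
    using d(1) by (auto simp: bij_betw_def inj_on_def)
  have range_d: "range d = B" and range_e: "range e = A"
    using d(1) e(1) by (auto simp: bij_betw_def)
  \<comment> \<open>\<open>G\<close> inverts \<open>d\<close> on \<open>B\<close>. Off
    \<open>B\<close> the factor \<open>char_fun B b\<close> makes the test vanish at once, so the
    search still halts, with default value 0.\<close>
  define G where "G b = (LEAST j. char_fun B b * (1 - of_bool (d j = b)) = 0)" for b
  have G: "G (d i) = i" for i
    unfolding G_def using range_d
    by (intro Least_equality) (auto simp: char_fun_def inj_d of_bool_def split: if_splits)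
  \<comment> \<open>The search variable is prepended: position 0 is the candidate \<open>j\<close>,
    position 1 the argument \<open>b\<close>.\<close>
  have "total_recursive_in ?F 1
    (\<lambda>xs. LEAST j. char_fun B ((j # xs) ! 1) * (1 - of_bool (d ((j # xs) ! 0) = (j # xs) ! 1)) = 0)"
  proof (rule total_recursive_in_mu)
    show "total_recursive_in ?F (Suc 1)
        (\<lambda>xs. char_fun B (xs ! 1) * (1 - of_bool (d (xs ! 0) = xs ! 1)))"
      by (intro total_recursive_in_mult B_rec total_recursive_in_diff
          total_recursive_in_of_bool_eq d_rec total_recursive_in_proj total_recursive_in_const) auto
    show "\<exists>j. char_fun B ((j # xs) ! 1) * (1 - of_bool (d ((j # xs) ! 0) = (j # xs) ! 1)) = 0"
      for xs
      using range_d by (auto simp: char_fun_def)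
  qed
  then have "total_recursive_in ?F 1 (\<lambda>xs. G (xs ! 0))"
    by (rule total_recursive_in_cong) (auto simp: G_def)
  note G_rec = total_recursive_in_comp1[OF this]
  \<comment> \<open>For \<open>b\<close> in \<open>B\<close> this is \<open>n \<le> e (G b)\<close>,
    where \<open>e (G b)\<close> is the isomorphism \<open>K\<close> at \<open>b\<close>. Off
    \<open>B\<close> the product is 0, so a positive \<open>n\<close> admits only elements of
    \<open>B\<close>.\<close>
  define P where "P n b \<longleftrightarrow> n - char_fun B b * e (G b) = 0" for n b
  have P_d: "P n (d i) \<longleftrightarrow> n \<le> e i" for n i
    using range_d by (auto simp: P_def char_fun_def G)
  \<comment> \<open>\<open>A\<close> is unbounded, so some \<open>e i\<close> is at least
    \<open>n\<close>, and \<open>d i\<close> is a witness.\<close>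
  have P_ex: "\<exists>b. P n b" for n
    using A(2) P_d unfolding range_e[symmetric] infinite_nat_iff_unbounded_le by blast
  have "total_recursive_in ?F 1
    (\<lambda>xs. LEAST b. (b # xs) ! 1 - char_fun B ((b # xs) ! 0) * e (G ((b # xs) ! 0)) = 0)"
  proof (rule total_recursive_in_mu)
    show "total_recursive_in ?F (Suc 1) (\<lambda>xs. xs ! 1 - char_fun B (xs ! 0) * e (G (xs ! 0)))"
      by (intro total_recursive_in_mult B_rec total_recursive_in_diff
          e_rec G_rec total_recursive_in_proj) auto
    show "\<exists>b. (b # xs) ! 1 - char_fun B ((b # xs) ! 0) * e (G ((b # xs) ! 0)) = 0" for xs
      using P_ex[of "xs ! 0"] by (simp add: P_def)
  qed
  then have least_rec: "total_recursive_in ?F 1 (\<lambda>xs. LEAST b. P (xs ! 0) b)"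
    by (rule total_recursive_in_cong) (auto simp: P_def)
  have "e (G (LEAST b. P n b)) = n" if "n \<in> A" for n
  proof -
    obtain i where i: "e i = n" using \<open>n \<in> A\<close> range_e by auto
    \<comment> \<open>Positivity matters: \<open>P 0 b\<close> holds for every \<open>b\<close>, and
      the least such \<open>b\<close> is 0 whether or not 0 lies in \<open>B\<close>.\<close>
    have "n > 0" using \<open>n \<in> A\<close> A(1) by auto
    have "(LEAST b. P n b) = d i"
    proof (rule Least_equality)
      show "P n (d i)" by (simp add: P_d i)
      show "d i \<le> b" if "P n b" for b
      proof -
        have "b \<in> B" using that \<open>n > 0\<close> by (auto simp: P_def char_fun_def split: if_splits)
        then obtain j where "b = d j" using range_d by auto
        \<comment> \<open>\<open>P n (d j)\<close> gives \<open>e i \<le> e j\<close>, which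
          \<open>order\<close> transfers to \<open>d i \<le> d j\<close>.\<close>
        with that show ?thesis using P_d order i by (metis not_less)
      qed
    qed
    then show ?thesis by (simp add: G i)
  qed
  \<comment> \<open>For the converse, every value of \<open>e\<close> lies in \<open>A\<close>, so
    the equality fails when \<open>n\<close> is outside \<open>A\<close>.\<close>
  then have "e (G (LEAST b. P n b)) = n \<longleftrightarrow> n \<in> A" for n
    using range_e by (metis rangeI)
  then have "of_bool (e (G (LEAST b. P n b)) = n) = char_fun A n" for n
    by (simp add: char_fun_def)
  moreover have "total_recursive_in ?F 1 (\<lambda>xs. of_bool (e (G (LEAST b. P (xs ! 0) b)) = xs ! 0))"
    by (intro total_recursive_in_of_bool_eq e_rec G_rec least_rec total_recursive_in_proj) auto
  ultimately show ?thesis by (simp add: turing_reducible_iff)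
qed

theorem theorem3p6:
  fixes A B :: "nat set"
  assumes "A \<subseteq> {1..}" and "B \<subseteq> {1..}"
    and "re_set A" and "re_set B"
    and "uniform_sets A B"
  shows "A \<equiv>\<^sub>T B"
proof (cases "finite A")
  case True
  moreover have "finite B"
    using True assms(5) eqpoll_finite_iff unfolding uniform_sets_def by blast
  ultimately show ?thesis
    unfolding turing_equiv_def turing_reducible_iff
    by (auto intro!: total_recursive_in_char_fun_finite total_recursive_in_proj)
next
  case False
  then have inf: "infinite B"
    using assms(5) eqpoll_finite_iff unfolding uniform_sets_def by blast
  obtain h g where hg: "listing A h" "listing B g" "uniform_listings h g"
    using assms(5) unfolding uniform_sets_def by blast
  \<comment> \<open>Uniformity is symmetric, so the one-sided reduction also applies with
    \<open>A\<close> and \<open>B\<close> exchanged.\<close>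
  then have gh: "uniform_listings g h"
    unfolding uniform_listings_def by auto
  show ?thesis
    unfolding turing_equiv_def
    using turing_reducible_if_uniform_infinite[OF assms(1) False inf hg]
      turing_reducible_if_uniform_infinite[OF assms(2) inf False hg(2,1) gh] by blast
qed

end
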